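(* Let $\mathbf{v}\in\mathbb{R}^s$ and let $A=(a_{i,j})\in\mathbb{R}^{s\times s}$ be a symmetric matrix. Let $r=2s$, $d=1+2r$, and consider the function $H(\mathbf{x},\mathbf{p})=\mathbf{v}\cdot\mathbf{x}+\tfrac12\mathbf{p}^\top A\mathbf{p}$ on $\mathbb{R}^r=\mathbb{R}^s\oplus\mathbb{R}^{s\ast}$. Let $\mathbf{x}_0,\mathbf{p}_0\in\mathbb{R}^s$ and $a\le0<b$. Then the curve $[a,b]\to\mathbb{R}^r$ given by $t\mapsto(\mathbf{x}(t),\mathbf{p}(t))$ is the integral curve of the Hamiltonian vector field $\Phi_H$ on $\mathbb{R}^r$ fulfilling $(\mathbf{x}(0),\mathbf{p}(0))=(\mathbf{x}_0,\mathbf{p}_0)$ if and only if the path $X(t)=(t,\mathbf{x}(t),\mathbf{p}(t),\mathbf{x}'(t),\mathbf{p}'(t))$ in $\mathbb{R}^d$ satisfies $$X(0)=(0,\mathbf{x}_0,\mathbf{p}_0,A\cdot\mathbf{x}_0,-\mathbf{v}),$$ $$\sum_{h=1}^s \langle\sigma(X),a_{i,h}(\mathtt{1+s+h})w\rangle=-\sum_{h=1}^s\langle\sigma(X),(\mathtt{1+r+h})w\rangle,$$ $$\langle\sigma(X),(\mathtt{1+3s+i})w\rangle=0$$ for every $i\in\{1,\dots,s\}$ and every word $w\in\mathbb{T}(\mathbb{R}^d)$.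
   Context: For a differentiable function $H(x_1,\dots,x_s,p_1,\dots,p_s)$ on $\mathbb{R}^{2s}$, the Hamiltonian vector field is $\Phi_H=\sum_{i=1}^s\left(\frac{\partial H}{\partial p_i}\frac{\partial}{\partial x_i}-\frac{\partial H}{\partial x_i}\frac{\partial}{\partial p_i}\right)$. A curve $(\mathbf{x}(t),\mathbf{p}(t))$ on $[a,b]$ is an integral curve of $\Phi_H$ if $x_i'(t)=\frac{\partial H}{\partial p_i}(\mathbf{x}(t),\mathbf{p}(t))$ and $p_i'(t)=-\frac{\partial H}{\partial x_i}(\mathbf{x}(t),\mathbf{p}(t))$ for all $i\in\{1,\dots,s\}$ and all $t\in[a,b]$. Paths are assumed throughout to be continuous and piecewise differentiable. Words and signature. $\mathbb{T}(\mathbb{R}^d)$ is the real vector space with basis all words (finite sequences, including the empty word $\varnothing$) in the alphabet $\{\mathtt{1},\dots,\mathtt{d}\}$. Juxtaposition denotes concatenation. $(\mathtt{1+s+h})$, $(\mathtt{1+r+h})$, $(\mathtt{1+3s+i})$ denote single letters, corresponding to the numbers $1+s+h$, $1+r+h$, $1+3s+i$. $\langle\sigma(X),\varnothing\rangle=1$ and $$\langle\sigma(X),\mathtt{i}_1\cdots\mathtt{i}_n\rangle=\int_a^b\int_a^{t_n}\cdots\int_a^{t_2}\dot X_{i_1}(t_1)\cdots\dot X_{i_n}(t_n)\,dt_1\cdots dt_n,$$ extended linearly to $\mathbb{T}(\mathbb{R}^d)$.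
   Formalization: The printed claim is false (e.g. s=1, A=1, v=1, x0=0, p0=1); here the initial value has A·p0 instead of A·x0, and the right-hand side of the first signature condition is the single term ⟨σ(X),(1+r+i)w⟩ instead of −Σ_h⟨σ(X),(1+r+h)w⟩. *)

theory Defs
  imports "HOL-Analysis.Analysis" "HOL-Library.Poly_Mapping"
begin

text \<open>
  Vectors in \<open>s\<close>-dimensional space are of type \<^typ>\<open>real^'s\<close>, phase space is
  \<open>(real^'s) \<times> (real^'s)\<close>, and the letters of words over \<open>'d\<close> are the coordinate indices of
  \<^typ>\<open>real^'d\<close>.
\<close>

definition partial_pos :: "((real^'s) \<times> (real^'s) \<Rightarrow> real) \<Rightarrow> 's \<Rightarrow> (real^'s) \<times> (real^'s) \<Rightarrow> real"
  where "partial_pos H i z = deriv (\<lambda>u. H (fst z + u *\<^sub>R axis i 1, snd z)) 0"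

definition partial_mom :: "((real^'s) \<times> (real^'s) \<Rightarrow> real) \<Rightarrow> 's \<Rightarrow> (real^'s) \<times> (real^'s) \<Rightarrow> real"
  where "partial_mom H i z = deriv (\<lambda>u. H (fst z, snd z + u *\<^sub>R axis i 1)) 0"

definition hamiltonian_vector_field ::
    "((real^'s) \<times> (real^'s) \<Rightarrow> real) \<Rightarrow> (real^'s) \<times> (real^'s) \<Rightarrow> (real^'s) \<times> (real^'s)"
  where "hamiltonian_vector_field H z = (\<chi> i. partial_mom H i z, \<chi> i. - partial_pos H i z)"

definition integral_curve ::
    "((real^'s) \<times> (real^'s) \<Rightarrow> (real^'s) \<times> (real^'s)) \<Rightarrow> real \<Rightarrow> real \<Rightarrow>
      (real \<Rightarrow> real^'s) \<Rightarrow> (real \<Rightarrow> real^'s) \<Rightarrow> bool"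
  where "integral_curve \<Phi> a b x p \<longleftrightarrow>
    (\<forall>t\<in>{a..b}. \<forall>i.
      ((\<lambda>u. x u $ i) has_real_derivative fst (\<Phi> (x t, p t)) $ i) (at t within {a..b}) \<and>
      ((\<lambda>u. p u $ i) has_real_derivative snd (\<Phi> (x t, p t)) $ i) (at t within {a..b}))"

text \<open>
  \<open>sig_rev X a b w t\<close> is the iterated integral over \<open>a \<le> t\<^sub>1 \<le> \<dots> \<le> t\<^sub>n \<le> t\<close> belonging to the
  word \<^term>\<open>rev w\<close>: the last letter of a word is integrated outermost. The velocity is the
  derivative within \<open>[a, b]\<close>, hence one-sided at the end points. Its (unspecified) value at the
  finitely many break points of a piecewise differentiable path does not affect the integrals.
\<close>

fun sig_rev :: "(real \<Rightarrow> real^'d) \<Rightarrow> real \<Rightarrow> real \<Rightarrow> 'd list \<Rightarrow> real \<Rightarrow> real"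
  where
    "sig_rev X a b [] t = 1"
  | "sig_rev X a b (i # w) t =
      integral {a..t} (\<lambda>u. sig_rev X a b w u * vector_derivative X (at u within {a..b}) $ i)"

definition sig_word :: "(real \<Rightarrow> real^'d) \<Rightarrow> real \<Rightarrow> real \<Rightarrow> 'd list \<Rightarrow> real"
  where "sig_word X a b w = sig_rev X a b (rev w) b"

text \<open>
  The vector space with basis the words is the type \<^typ>\<open>'d list \<Rightarrow>\<^sub>0 real\<close> of finitely supported
  functions on words; the scalar multiple \<open>c w\<close> of a word is \<^term>\<open>Poly_Mapping.single w c\<close>.
\<close>

definition sig_pairing :: "(real \<Rightarrow> real^'d) \<Rightarrow> real \<Rightarrow> real \<Rightarrow> ('d list \<Rightarrow>\<^sub>0 real) \<Rightarrow> real"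
  where "sig_pairing X a b f =
    (\<Sum>w\<in>Poly_Mapping.keys f. Poly_Mapping.lookup f w * sig_word X a b w)"

text \<open>
  The \<open>d = 1 + 4s\<close> coordinates of the path \<open>(t, x, p, x', p')\<close>. With \<open>r = 2s\<close>, the letters
  numbered \<open>1\<close>, \<open>1 + h\<close>, \<open>1 + s + h\<close>, \<open>1 + r + h\<close>, \<open>1 + 3s + h\<close> for \<open>h = 1, \<dots>, s\<close> are
  \<open>Time\<close>, \<open>Pos h\<close>, \<open>Mom h\<close>, \<open>DPos h\<close>, \<open>DMom h\<close>.
\<close>

datatype 's letter = Time | Pos 's | Mom 's | DPos 's | DMom 's

lemma UNIV_letter:
  "(UNIV :: 's letter set) = insert Time (range Pos \<union> range Mom \<union> range DPos \<union> range DMom)"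
proof -
  have "l \<in> insert Time (range Pos \<union> range Mom \<union> range DPos \<union> range DMom)" for l :: "'s letter"
    by (cases l) auto
  then show ?thesis by blast
qed

instance letter :: (finite) finite
  by standard (simp add: UNIV_letter)

lemma card_letter: "CARD('s::finite letter) = 1 + 4 * CARD('s)"
proof -
  have "card (range Pos \<union> range Mom \<union> range DPos \<union> range DMom :: 's letter set) = 4 * CARD('s)"
    by (subst card_Un_disjoint; auto simp: card_image inj_on_def)+
  then show ?thesis
    by (subst UNIV_letter, subst card_insert_disjoint) auto
qed

definition extended_point ::
    "real \<Rightarrow> real^'s \<Rightarrow> real^'s \<Rightarrow> real^'s \<Rightarrow> real^'s \<Rightarrow> real^('s::finite letter)"
  where "extended_point t x p x' p' =
    (\<chi> l. case l of Time \<Rightarrow> t | Pos h \<Rightarrow> x $ h | Mom h \<Rightarrow> p $ h | DPos h \<Rightarrow> x' $ h | DMom h \<Rightarrow> p' $ h)"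

definition extended_path ::
    "real \<Rightarrow> real \<Rightarrow> (real \<Rightarrow> real^'s) \<Rightarrow> (real \<Rightarrow> real^'s) \<Rightarrow> real \<Rightarrow> real^('s::finite letter)"
  where "extended_path a b x p t =
    extended_point t (x t) (p t)
      (vector_derivative x (at t within {a..b})) (vector_derivative p (at t within {a..b}))"

text \<open>
  The extended curve \<open>(t, x, p, x', p')\<close> is a path: \<open>x'\<close> and \<open>p'\<close> exist on all of \<open>[a, b]\<close>, and
  the curve is continuous and piecewise differentiable. The first two conditions are needed because
  \<^const>\<open>vector_derivative\<close> is total.
\<close>

definition is_extended_path ::
    "real \<Rightarrow> real \<Rightarrow> (real \<Rightarrow> real^'s) \<Rightarrow> (real \<Rightarrow> real^'s::finite) \<Rightarrow> bool"
  where "is_extended_path a b x p \<longleftrightarrow>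
    x differentiable_on {a..b} \<and> p differentiable_on {a..b} \<and>
    extended_path a b x p piecewise_differentiable_on {a..b}"

text \<open>
  The signature conditions below express, for the quadratic Hamiltonian
  \<open>H(x, p) = v \<bullet> x + p \<bullet> (A p) / 2\<close>, the equations \<open>x' = A p\<close> and \<open>p' = - v\<close> up to constants,
  and the initial value \<open>(0, x\<^sub>0, p\<^sub>0, A p\<^sub>0, - v)\<close> fixes these constants. The source prints \<open>A x\<^sub>0\<close> for
  \<open>A p\<^sub>0\<close> and, as right-hand side of the first signature condition, minus the sum over \<open>h\<close> of the
  terms for \<open>DPos h\<close>, instead of the single term for \<open>DPos i\<close>. With either the equivalence fails,
  already for \<open>s = 1\<close>, \<open>A = 1\<close>, \<open>v = 1\<close>, \<open>x\<^sub>0 = 0\<close>, \<open>p\<^sub>0 = 1\<close>.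
\<close>

end

theory Submission
  imports Defs
begin

text \<open>
  A relation between letters that holds for the increments \<open>X(t) - X(a)\<close> propagates through further
  integrations, hence to all words that start with these letters. Conversely, since \<open>X\<close> has time as
  a coordinate, testing with \<open>w = Time\<^sup>n\<close> says that all iterated integrals over \<open>[a, b]\<close> of the
  continuous defect \<open>g\<close> of the relation vanish. By partial integration \<open>g\<close> is orthogonal to all
  polynomials, and by Weierstrass approximation \<open>g = 0\<close>. Thus the signature conditions say that
  \<open>x' - A p\<close> and \<open>p'\<close> are constant, and the initial value gives \<open>x' = A p\<close> and \<open>p' = - v\<close>, which
  are Hamilton's equations.
\<close>

section \<open>Analytic preliminaries: functions with vanishing moments\<close>

lemma has_vector_derivative_vec_iff:
  fixes f :: "real \<Rightarrow> real^'n"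
  shows "(f has_vector_derivative D) (at t within S) \<longleftrightarrow>
    (\<forall>i. ((\<lambda>u. f u $ i) has_real_derivative D $ i) (at t within S))"
proof -
  have "(f has_vector_derivative D) (at t within S) \<longleftrightarrow>
      (\<forall>i. ((\<lambda>u. f u $ i) has_derivative (\<lambda>h. (h *\<^sub>R D) $ i)) (at t within S))"
    unfolding has_vector_derivative_def
    by (subst has_derivative_componentwise_within) (auto simp: Basis_vec_def inner_axis)
  moreover have "(\<lambda>h. (h *\<^sub>R D) $ i) = (*) (D $ i)" for i
    by (simp add: fun_eq_iff)
  ultimately show ?thesis
    by (simp add: has_field_derivative_def)
qed

text \<open>If a polynomial \<open>q\<close> is within \<open>e\<close> of \<open>g\<close>,
  orthogonality lets one replace the integral of \<open>g * g\<close> by that of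
  \<open>g * (g - q)\<close>, which is at most \<open>e\<close> times the integral of the absolute
  value of \<open>g\<close>. Letting \<open>e\<close> tend to 0 kills the integral of a continuous
  nonnegative function.\<close>

lemma orthogonal_to_polynomials_imp_zero:
  fixes g :: "real \<Rightarrow> real"
  assumes "a < b" and g: "continuous_on {a..b} g"
    and moments: "\<And>n. integral {a..b} (\<lambda>t. g t * t ^ n) = 0"
    and t: "t \<in> {a..b}"
  shows "g t = 0"
proof -
  let ?M = "integral {a..b} (\<lambda>t. \<bar>g t\<bar>)"
  have le: "integral {a..b} (\<lambda>t. g t * g t) \<le> e * ?M" if "e > 0" for e
  proof -
    obtain q where q: "real_polynomial_function q" and approx: "\<And>x. x \<in> {a..b} \<Longrightarrow> \<bar>g x - q x\<bar> < e"
      using Stone_Weierstrass_real_polynomial_function[OF compact_Icc g \<open>e > 0\<close>] by blast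
    obtain c and n :: nat where q_eq: "q = (\<lambda>x. \<Sum>i\<le>n. c i * x ^ i)"
      using real_polynomial_function_imp_sum[OF q] by blast
    have q_cont: "continuous_on {a..b} q"
      unfolding q_eq by (intro continuous_intros)
    have "integral {a..b} (\<lambda>t. g t * q t) = integral {a..b} (\<lambda>t. \<Sum>i\<le>n. c i * (g t * t ^ i))"
      unfolding q_eq by (simp add: sum_distrib_left mult_ac)
    also have "\<dots> = (\<Sum>i\<le>n. integral {a..b} (\<lambda>t. c i * (g t * t ^ i)))"
      by (intro integral_sum integrable_continuous_real continuous_intros g) auto
    also have "\<dots> = 0"
      by (simp add: moments)
    finally have zero: "integral {a..b} (\<lambda>t. g t * q t) = 0" .
    have "integral {a..b} (\<lambda>t. g t * g t) =
        integral {a..b} (\<lambda>t. g t * g t) - integral {a..b} (\<lambda>t. g t * q t)"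
      by (simp add: zero)
    also have "\<dots> = integral {a..b} (\<lambda>t. g t * g t - g t * q t)"
      by (intro integral_diff[symmetric] integrable_continuous_real continuous_intros g q_cont)
    also have "\<dots> \<le> integral {a..b} (\<lambda>t. e * \<bar>g t\<bar>)"
    proof (intro integral_le integrable_continuous_real continuous_intros g q_cont)
      fix x assume "x \<in> {a..b}"
      have "g x * g x - g x * q x \<le> \<bar>g x\<bar> * \<bar>g x - q x\<bar>"
        by (metis abs_ge_self abs_mult right_diff_distrib)
      also have "\<dots> \<le> \<bar>g x\<bar> * e"
        using approx[OF \<open>x \<in> {a..b}\<close>] by (intro mult_left_mono) auto
      finally show "g x * g x - g x * q x \<le> e * \<bar>g x\<bar>" by (simp add: mult.commute)
    qed
    finally show ?thesis by simp
  qed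
  have M: "?M \<ge> 0"
    by (intro integral_nonneg integrable_continuous_real continuous_intros g) auto
  have "integral {a..b} (\<lambda>t. g t * g t) \<le> 0"
  proof (rule field_le_epsilon)
    fix e :: real assume "e > 0"
    \<comment> \<open>Dividing by \<open>?M + 1\<close> rather than by \<open>?M\<close> covers the
      case \<open>?M = 0\<close>.\<close>
    have "e / (?M + 1) * ?M \<le> e"
      using M \<open>e > 0\<close> by (simp add: field_simps)
    then show "integral {a..b} (\<lambda>t. g t * g t) \<le> 0 + e"
      using le[of "e / (?M + 1)"] M \<open>e > 0\<close> by simp
  qed
  moreover have "integral {a..b} (\<lambda>t. g t * g t) \<ge> 0"
    by (intro integral_nonneg integrable_continuous_real continuous_intros g) auto
  ultimately have "integral {a..b} (\<lambda>t. g t * g t) = 0" by simp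
  moreover have "continuous_on {a..b} (\<lambda>t. g t * g t)"
    by (intro continuous_intros g)
  ultimately show ?thesis
    using integral_eq_0_iff[of a b "\<lambda>t. g t * g t"] \<open>a < b\<close> t by simp
qed

text \<open>Each \<open>G (Suc n)\<close> is an antiderivative of \<open>G n\<close> that vanishes
  at both ends, so partial integration has no boundary terms and gives all moments of
  \<open>G 0\<close> the value 0.\<close>

lemma vanishing_iterated_integrals_imp_zero:
  fixes G :: "nat \<Rightarrow> real \<Rightarrow> real"
  assumes "a < b" and G0: "continuous_on {a..b} (G 0)"
    and deriv: "\<And>n t. t \<in> {a..b} \<Longrightarrow> (G (Suc n) has_real_derivative G n t) (at t within {a..b})"
    and start: "\<And>n. G (Suc n) a = 0" and stop: "\<And>n. G (Suc n) b = 0"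
    and t: "t \<in> {a..b}"
  shows "G 0 t = 0"
proof -
  have cont: "continuous_on {a..b} (G k)" for k
    by (cases k) (auto intro: G0 DERIV_continuous_on[OF deriv])
  have "integral {a..b} (\<lambda>t. G k t * t ^ n) = 0" for k n
  \<comment> \<open>Partial integration lowers the exponent \<open>n\<close> but raises the index
    \<open>k\<close>, so \<open>k\<close> must vary.\<close>
  proof (induction n arbitrary: k)
    case 0
    have "(G k has_integral G (Suc k) b - G (Suc k) a) {a..b}"
      using \<open>a < b\<close> deriv
      by (intro fundamental_theorem_of_calculus)
        (auto simp: has_real_derivative_iff_has_vector_derivative[symmetric])
    then show ?case by (simp add: start stop integral_unique)
  next
    case (Suc n)
    have "((\<lambda>t. G k t * t ^ Suc n + real (Suc n) * (G (Suc k) t * t ^ n)) has_integral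
        G (Suc k) b * b ^ Suc n - G (Suc k) a * a ^ Suc n) {a..b}"
    proof (intro fundamental_theorem_of_calculus)
      fix x assume "x \<in> {a..b}"
      from deriv[OF this, of k] show
        "((\<lambda>t. G (Suc k) t * t ^ Suc n) has_vector_derivative
          G k x * x ^ Suc n + real (Suc n) * (G (Suc k) x * x ^ n)) (at x within {a..b})"
        unfolding has_real_derivative_iff_has_vector_derivative[symmetric]
        by (auto intro!: derivative_eq_intros simp del: power_Suc)
    qed (use \<open>a < b\<close> in auto)
    then have "0 = integral {a..b} (\<lambda>t. G k t * t ^ Suc n + real (Suc n) * (G (Suc k) t * t ^ n))"
      by (simp add: start stop integral_unique del: power_Suc)
    also have "\<dots> = integral {a..b} (\<lambda>t. G k t * t ^ Suc n)
        + integral {a..b} (\<lambda>t. real (Suc n) * (G (Suc k) t * t ^ n))"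
      by (intro integral_add integrable_continuous_real continuous_intros cont)
    finally show ?case using Suc.IH[of "Suc k"] by simp
  qed
  then show ?thesis
    using orthogonal_to_polynomials_imp_zero[OF \<open>a < b\<close> G0 _ t] by blast
qed

section \<open>Linear relations between letters in the signature\<close>

text \<open>The fundamental theorem of calculus tolerates finitely many break points because
  \<open>X\<close> is continuous across them.\<close>

lemma sig_rev_singleton:
  fixes X :: "real \<Rightarrow> real^'d"
  assumes X: "X piecewise_differentiable_on {a..b}" and t: "t \<in> {a..b}"
  shows "sig_rev X a b [l] t = X t $ l - X a $ l"
proof -
  obtain S where "finite S" and diff: "\<And>u. u \<in> {a..b} - S \<Longrightarrow> X differentiable (at u within {a..b})"
    and cont: "continuous_on {a..b} X"
    using X unfolding piecewise_differentiable_on_def by blast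
  have "((\<lambda>u. vector_derivative X (at u within {a..b}) $ l) has_integral X t $ l - X a $ l) {a..t}"
  proof (rule fundamental_theorem_of_calculus_interior_strong[OF \<open>finite S\<close>])
    fix u assume u: "u \<in> {a<..<t} - S"
    then have "(X has_vector_derivative vector_derivative X (at u within {a..b})) (at u within {a..b})"
      using diff[of u] t vector_derivative_works by auto
    then have "((\<lambda>u. X u $ l) has_vector_derivative vector_derivative X (at u within {a..b}) $ l)
        (at u within {a..b})"
      by (rule bounded_linear.has_vector_derivative[OF bounded_linear_vec_nth])
    moreover have "at u within {a..b} = at u"
      using u t by (intro at_within_Icc_at) auto
    ultimately show
      "((\<lambda>u. X u $ l) has_vector_derivative vector_derivative X (at u within {a..b}) $ l) (at u)"
      by simp
  next
    show "continuous_on {a..t} (\<lambda>u. X u $ l)"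
      by (intro continuous_intros continuous_on_subset[OF cont]) (use t in auto)
  qed (use t in auto)
  then show ?thesis by (simp add: integral_unique)
qed

lemma continuous_on_sig_rev:
  assumes "continuous_on {a..b} (\<lambda>u. vector_derivative X (at u within {a..b}))"
  shows "continuous_on {a..b} (sig_rev X a b w)"
proof (induction w)
  case (Cons l w)
  then show ?case
    by (simp, intro indefinite_integral_continuous_1 integrable_continuous_real continuous_intros assms)
qed simp

text \<open>In the reversed words of \<open>sig_rev\<close>, a letter appended at the end is the
  innermost one. Linearity of the integral then carries the relation outward through
  \<open>w\<close>, one letter at a time.\<close>

lemma sig_rev_append_relation:
  fixes X :: "real \<Rightarrow> real^'d"
  assumes V: "continuous_on {a..b} (\<lambda>u. vector_derivative X (at u within {a..b}))"
    and rel: "\<And>t. t \<in> {a..b} \<Longrightarrow> (\<Sum>k\<in>K. c k * sig_rev X a b [l k] t) = sig_rev X a b [m] t"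
    and "t \<in> {a..b}"
  shows "(\<Sum>k\<in>K. c k * sig_rev X a b (w @ [l k]) t) = sig_rev X a b (w @ [m]) t"
  using \<open>t \<in> {a..b}\<close>
proof (induction w arbitrary: t)
  case Nil
  then show ?case using rel by simp
next
  case (Cons j w)
  let ?V = "\<lambda>u. vector_derivative X (at u within {a..b}) $ j"
  have sub: "{a..t} \<subseteq> {a..b}" using Cons.prems by auto
  have int: "(\<lambda>u. c k * (sig_rev X a b (w @ [l k]) u * ?V u)) integrable_on {a..t}" for k
    by (intro integrable_continuous_real continuous_intros
      continuous_on_subset[OF continuous_on_sig_rev[OF V] sub] continuous_on_subset[OF V sub])
  show ?case
  proof (cases "finite K")
    case True
    have "(\<Sum>k\<in>K. c k * sig_rev X a b ((j # w) @ [l k]) t) =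
        (\<Sum>k\<in>K. integral {a..t} (\<lambda>u. c k * (sig_rev X a b (w @ [l k]) u * ?V u)))"
      by simp
    also have "\<dots> = integral {a..t} (\<lambda>u. \<Sum>k\<in>K. c k * (sig_rev X a b (w @ [l k]) u * ?V u))"
      using int True by (intro integral_sum[symmetric]) auto
    also have "\<dots> = integral {a..t} (\<lambda>u. (\<Sum>k\<in>K. c k * sig_rev X a b (w @ [l k]) u) * ?V u)"
      by (simp add: sum_distrib_right mult.assoc)
    also have "\<dots> = integral {a..t} (\<lambda>u. sig_rev X a b (w @ [m]) u * ?V u)"
      using sub by (intro integral_cong) (auto simp: Cons.IH)
    finally show ?thesis by simp
  next
    \<comment> \<open>A sum over an infinite \<open>K\<close> is 0 by convention, so the induction
      hypothesis says that the right-hand side vanishes for \<open>w\<close>.\<close>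
    case False
    then have "integral {a..t} (\<lambda>u. sig_rev X a b (w @ [m]) u * ?V u) = integral {a..t} (\<lambda>u. 0)"
      using sub Cons.IH by (intro integral_cong) (auto simp: Cons.IH[symmetric])
    with False show ?thesis by simp
  qed
qed

text \<open>Since \<open>\<tau>\<close> moves with speed 1, every further letter
  \<open>\<tau>\<close> is plain integration in time. The values on the words ending in powers of
  \<open>\<tau>\<close> are therefore the end values of the iterated integrals of the defect of the
  relation, and their vanishing forces the defect to be 0.\<close>

lemma relation_of_signature_relations:
  fixes X :: "real \<Rightarrow> real^'d"
  assumes "a < b" and X: "X piecewise_differentiable_on {a..b}"
    and time: "\<And>t. t \<in> {a..b} \<Longrightarrow> X t $ \<tau> = t"
    and rel: "\<And>n. (\<Sum>k\<in>K. c k * sig_word X a b (l k # replicate n \<tau>)) = sig_word X a b (m # replicate n \<tau>)"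
    and t: "t \<in> {a..b}"
  shows "(\<Sum>k\<in>K. c k * (X t $ l k - X a $ l k)) = X t $ m - X a $ m"
proof -
  \<comment> \<open>\<open>S n j u\<close> belongs to the word
    \<open>j # replicate n \<tau>\<close>, integrated only up to \<open>u\<close>;
    \<open>G 0\<close> is the defect of the relation and \<open>G n\<close> its
    \<open>n\<close>-fold integral.\<close>
  define S where "S n j = sig_rev X a b (replicate n \<tau> @ [j])" for n j
  define G where "G n u = (\<Sum>k\<in>K. c k * S n (l k) u) - S n m u" for n u
  obtain B where "finite B"
    and diff: "\<And>u. u \<in> {a..b} - B \<Longrightarrow> X differentiable (at u within {a..b})"
    and X_cont: "continuous_on {a..b} X"
    using X unfolding piecewise_differentiable_on_def by blast
  have speed: "vector_derivative X (at u within {a..b}) $ \<tau> = 1" if u: "u \<in> {a..b} - B" for u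
  proof -
    have "(X has_vector_derivative vector_derivative X (at u within {a..b})) (at u within {a..b})"
      using diff[OF u] vector_derivative_works by blast
    then have "((\<lambda>u. X u $ \<tau>) has_vector_derivative vector_derivative X (at u within {a..b}) $ \<tau>)
        (at u within {a..b})"
      by (rule bounded_linear.has_vector_derivative[OF bounded_linear_vec_nth])
    moreover have "((\<lambda>u. X u $ \<tau>) has_vector_derivative 1) (at u within {a..b})"
      using u time
      by (intro has_vector_derivative_transform[OF _ _ has_vector_derivative_id]) auto
    ultimately show ?thesis
      using vector_derivative_unique_within_closed_interval[OF \<open>a < b\<close>] u by (metis DiffD1 box_real(2))
  qed
  have S_0: "S 0 j u = X u $ j - X a $ j" if "u \<in> {a..b}" for j u
    using sig_rev_singleton[OF X that] by (simp add: S_def)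
  have S_Suc: "S (Suc n) j u = integral {a..u} (S n j)" if "u \<in> {a..b}" for n j u
  proof -
    have "S (Suc n) j u =
        integral {a..u} (\<lambda>r. S n j r * vector_derivative X (at r within {a..b}) $ \<tau>)"
      by (simp add: S_def)
    also have "\<dots> = integral {a..u} (S n j)"
      \<comment> \<open>The speed is known to be 1 only off the finite set \<open>B\<close>, which
        is negligible.\<close>
      using that speed by (intro integral_spike[OF negligible_finite[OF \<open>finite B\<close>]]) auto
    finally show ?thesis .
  qed
  \<comment> \<open>Continuity is kept as a premise here because it is proved next by an induction
    that uses this very derivative.\<close>
  have deriv_of_cont: "(S (Suc n) j has_real_derivative S n j u) (at u within {a..b})"
    if "u \<in> {a..b}" "continuous_on {a..b} (S n j)" for n j u
    by (rule has_field_derivative_transform_within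
        [OF integral_has_real_derivative[OF that(2,1)] zero_less_one that(1)]) (simp add: S_Suc)
  have S_cont: "continuous_on {a..b} (S n j)" for n j
  proof (induction n)
    case 0
    have "continuous_on {a..b} (\<lambda>u. X u $ j - X a $ j)"
      by (intro continuous_intros X_cont)
    then show ?case
      by (rule continuous_on_eq) (simp add: S_0)
  next
    case (Suc n)
    show ?case
      by (rule DERIV_continuous_on[OF deriv_of_cont[OF _ Suc]])
  qed
  have S_b: "S n j b = sig_word X a b (j # replicate n \<tau>)" for n j
    by (simp add: S_def sig_word_def)
  have "G 0 t = 0"
  proof (rule vanishing_iterated_integrals_imp_zero[OF \<open>a < b\<close> _ _ _ _ t])
    show "continuous_on {a..b} (G 0)"
      unfolding G_def by (intro continuous_intros S_cont)
    show "(G (Suc n) has_real_derivative G n u) (at u within {a..b})" if "u \<in> {a..b}" for n u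
      unfolding G_def[abs_def] by (intro DERIV_diff DERIV_sum DERIV_cmult deriv_of_cont S_cont that)
    show "G (Suc n) a = 0" for n
      using \<open>a < b\<close> by (simp add: G_def S_Suc)
    show "G (Suc n) b = 0" for n
      using rel[of "Suc n"] by (simp only: G_def S_b)
  qed
  then show ?thesis
    using t by (simp add: G_def S_0)
qed

section \<open>The quadratic Hamiltonian and the extended curve\<close>

lemma hamiltonian_vector_field_quadratic:
  fixes v :: "real^'s" and A :: "real^'s^'s"
  assumes A: "transpose A = A"
  shows "hamiltonian_vector_field (\<lambda>(y, q). v \<bullet> y + 1 / 2 * (q \<bullet> (A *v q))) z = (A *v snd z, - v)"
proof -
  obtain y q where z: "z = (y, q)" by (cases z)
  have sym: "axis i 1 \<bullet> (A *v q) = q \<bullet> (A *v axis i 1)" for i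
    by (metis A dot_lmul_matrix inner_commute vector_transpose_matrix)
  have "((\<lambda>u. v \<bullet> y + 1 / 2 * ((q + u *\<^sub>R axis i 1) \<bullet> (A *v (q + u *\<^sub>R axis i 1))))
      has_real_derivative (A *v q) $ i) (at 0)" for i
  proof -
    \<comment> \<open>Along a coordinate axis the Hamiltonian is a quadratic polynomial in
      \<open>u\<close>. By the symmetry of \<open>A\<close> the two mixed terms agree, and the
      factor 1/2 cancels their doubling.\<close>
    have "((\<lambda>u. v \<bullet> y + 1 / 2 * (q \<bullet> (A *v q) + 2 * u * (axis i 1 \<bullet> (A *v q))
        + u * u * (axis i 1 \<bullet> (A *v axis i 1)))) has_real_derivative axis i 1 \<bullet> (A *v q)) (at 0)"
      by (auto intro!: derivative_eq_intros)
    moreover have "(q + u *\<^sub>R axis i 1) \<bullet> (A *v (q + u *\<^sub>R axis i 1)) =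
        q \<bullet> (A *v q) + 2 * u * (axis i 1 \<bullet> (A *v q)) + u * u * (axis i 1 \<bullet> (A *v axis i 1))" for u
      using sym[of i]
      by (simp add: matrix_vector_right_distrib matrix_vector_mult_scaleR inner_add_left
          inner_add_right algebra_simps)
    ultimately show ?thesis by (simp add: inner_axis')
  qed
  then have "partial_mom (\<lambda>(y, q). v \<bullet> y + 1 / 2 * (q \<bullet> (A *v q))) i z = (A *v q) $ i" for i
    by (auto simp: partial_mom_def z intro!: DERIV_imp_deriv)
  moreover have "partial_pos (\<lambda>(y, q). v \<bullet> y + 1 / 2 * (q \<bullet> (A *v q))) i z = v $ i" for i
    unfolding partial_pos_def z
    by (rule DERIV_imp_deriv)
      (auto intro!: derivative_eq_intros simp: inner_add_right inner_axis)
  ultimately show ?thesis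
    by (simp add: hamiltonian_vector_field_def vec_eq_iff z)
qed

lemma extended_point_nth [simp]:
  "extended_point t x p x' p' $ Time = t"
  "extended_point t x p x' p' $ Pos h = x $ h"
  "extended_point t x p x' p' $ Mom h = p $ h"
  "extended_point t x p x' p' $ DPos h = x' $ h"
  "extended_point t x p x' p' $ DMom h = p' $ h"
  by (simp_all add: extended_point_def)

lemma extended_point_eq_iff:
  "extended_point t x p x' p' = extended_point u y q y' q' \<longleftrightarrow>
    t = u \<and> x = y \<and> p = q \<and> x' = y' \<and> p' = q'"
  by (metis extended_point_nth vec_eq_iff)

lemma sig_pairing_single [simp]: "sig_pairing X a b (Poly_Mapping.single w c) = c * sig_word X a b w"
  \<comment> \<open>For \<open>c = 0\<close> the set of keys is empty; otherwise it is the singleton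
    of \<open>w\<close>.\<close>
  by (cases "c = 0") (simp_all add: sig_pairing_def)

theorem corollary6p6:
  fixes v x0 p0 :: "real^'s" and A :: "real^'s^'s" and a b :: real
    and x p :: "real \<Rightarrow> real^'s"
  assumes "transpose A = A" and "a \<le> 0" and "0 < b"
  shows "(integral_curve
            (hamiltonian_vector_field (\<lambda>(y, q). v \<bullet> y + 1 / 2 * (q \<bullet> (A *v q)))) a b x p \<and>
          x 0 = x0 \<and> p 0 = p0)
     \<longleftrightarrow>
         (is_extended_path a b x p \<and>
          extended_path a b x p 0 = extended_point 0 x0 p0 (A *v p0) (- v) \<and>
          (\<forall>i. \<forall>w.
             (\<Sum>h\<in>UNIV. sig_pairing (extended_path a b x p) a b
                          (Poly_Mapping.single (Mom h # w) (A $ i $ h))) =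
               sig_pairing (extended_path a b x p) a b (Poly_Mapping.single (DPos i # w) 1) \<and>
             sig_pairing (extended_path a b x p) a b (Poly_Mapping.single (DMom i # w) 1) = 0))"
    (is "?curve \<and> ?init \<longleftrightarrow> ?path \<and> ?start \<and> ?sig")
proof -
  have "a < b" and zero: "0 \<in> {a..b}" using assms by auto
  let ?X = "extended_path a b x p"
  let ?dx = "\<lambda>t. vector_derivative x (at t within {a..b})"
  let ?dp = "\<lambda>t. vector_derivative p (at t within {a..b})"
  have mul: "(A *v q) $ i = (\<Sum>h\<in>UNIV. A $ i $ h * q $ h)" for q i
    by (simp add: matrix_vector_mult_def)
  have curve_iff: "?curve \<longleftrightarrow> (\<forall>t\<in>{a..b}. (x has_vector_derivative A *v p t) (at t within {a..b}) \<and>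
      (p has_vector_derivative - v) (at t within {a..b}))"
    unfolding integral_curve_def hamiltonian_vector_field_quadratic[OF assms(1)]
    by (auto simp: has_vector_derivative_vec_iff)
  show ?thesis
  proof
    assume lhs: "?curve \<and> ?init"
    have x': "(x has_vector_derivative A *v p t) (at t within {a..b})"
      and p': "(p has_vector_derivative - v) (at t within {a..b})" if "t \<in> {a..b}" for t
      using lhs that curve_iff by auto
    have X_eq: "?X t = extended_point t (x t) (p t) (A *v p t) (- v)" if "t \<in> {a..b}" for t
      using vector_derivative_within_closed_interval[OF \<open>a < b\<close> that x'[OF that]]
        vector_derivative_within_closed_interval[OF \<open>a < b\<close> that p'[OF that]]
      by (simp add: extended_path_def)
    \<comment> \<open>This is the velocity of the extended curve: since \<open>p' = - v\<close> is
      constant, differentiating \<open>x' = A p\<close> gives \<open>x'' = A (- v)\<close>, and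
      \<open>p'' = 0\<close>. Its continuity is what propagating the letter relations
      requires.\<close>
    define V where "V t = extended_point 1 (A *v p t) (- v) (A *v (- v)) 0" for t
    have X': "(?X has_vector_derivative V t) (at t within {a..b})" if t: "t \<in> {a..b}" for t
    proof (rule has_vector_derivative_transform[OF t X_eq])
      have Ap': "((\<lambda>u. A *v p u) has_vector_derivative A *v (- v)) (at t within {a..b})"
        by (intro bounded_linear.has_vector_derivative[OF _ p'[OF t]]) simp
      show "((\<lambda>u. extended_point u (x u) (p u) (A *v p u) (- v)) has_vector_derivative V t)
          (at t within {a..b})"
        unfolding has_vector_derivative_vec_iff V_def
      proof
        fix l :: "'s letter"
        show "((\<lambda>u. extended_point u (x u) (p u) (A *v p u) (- v) $ l) has_real_derivative
            extended_point 1 (A *v p t) (- v) (A *v (- v)) 0 $ l) (at t within {a..b})"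
          using x'[OF t] p'[OF t] Ap'
          by (cases l) (auto simp: has_vector_derivative_vec_iff)
      qed
    qed
    have X_pw: "?X piecewise_differentiable_on {a..b}"
      using X' by (intro differentiable_imp_piecewise_differentiable) (blast intro: differentiableI_vector)
    have path: ?path
      unfolding is_extended_path_def differentiable_on_def
      using x' p' X_pw by (blast intro: differentiableI_vector)
    have p_cont: "continuous_on {a..b} p"
      using p' by (meson continuous_on_eq_continuous_within has_vector_derivative_continuous)
    have V_cont: "continuous_on {a..b} V"
      unfolding V_def[abs_def] extended_point_def
    proof (intro continuous_on_vec_lambda)
      fix l :: "'s letter"
      show "continuous_on {a..b} (\<lambda>t. case l of Time \<Rightarrow> 1 | Pos h \<Rightarrow> (A *v p t) $ h
          | Mom h \<Rightarrow> (- v) $ h | DPos h \<Rightarrow> (A *v (- v)) $ h | DMom h \<Rightarrow> 0 $ h)"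
        by (cases l) (auto simp: mul intro!: continuous_intros p_cont)
    qed
    have V: "continuous_on {a..b} (\<lambda>u. vector_derivative ?X (at u within {a..b}))"
      by (rule continuous_on_eq[OF V_cont])
        (simp add: vector_derivative_within_closed_interval[OF \<open>a < b\<close> _ X'])
    have a: "a \<in> {a..b}" using \<open>a < b\<close> by simp
    \<comment> \<open>For single letters this is the increment of \<open>x' = A p\<close> over an
      interval starting at \<open>a\<close>.\<close>
    have "(\<Sum>h\<in>UNIV. A $ i $ h * sig_rev ?X a b (w @ [Mom h]) b) = sig_rev ?X a b (w @ [DPos i]) b"
      for i w
      using \<open>a < b\<close> a
      by (intro sig_rev_append_relation[OF V])
        (auto simp del: sig_rev.simps simp: sig_rev_singleton[OF X_pw] X_eq mul right_diff_distrib
          sum_subtractf)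
    \<comment> \<open>The empty index set makes the left side 0, so the same lemma shows that words
      starting with \<open>DMom i\<close> vanish; the base case holds because \<open>p'\<close> is
      constant.\<close>
    moreover have "(\<Sum>h\<in>{}. (0::real) * sig_rev ?X a b (w @ [Mom h]) b) = sig_rev ?X a b (w @ [DMom i]) b"
      for i w
      using \<open>a < b\<close> a
      by (intro sig_rev_append_relation[OF V])
        (auto simp del: sig_rev.simps simp: sig_rev_singleton[OF X_pw] X_eq)
    ultimately have ?sig
      by (simp add: sig_word_def)
    with path lhs X_eq[OF zero] show "?path \<and> ?start \<and> ?sig" by simp
  next
    assume rhs: "?path \<and> ?start \<and> ?sig"
    have X_pw: "?X piecewise_differentiable_on {a..b}"
      and x_diff: "x differentiable_on {a..b}" and p_diff: "p differentiable_on {a..b}"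
      using rhs by (auto simp: is_extended_path_def)
    have init: "x 0 = x0" "p 0 = p0" "?dx 0 = A *v p0" "?dp 0 = - v"
      using rhs by (auto simp: extended_path_def extended_point_eq_iff)
    have time: "?X t $ Time = t" for t
      by (simp add: extended_path_def)
    have "(A *v p t) $ i - (A *v p a) $ i = ?dx t $ i - ?dx a $ i" if "t \<in> {a..b}" for t i
    proof -
      have "(\<Sum>h\<in>UNIV. A $ i $ h * (?X t $ Mom h - ?X a $ Mom h)) = ?X t $ DPos i - ?X a $ DPos i"
        using rhs by (intro relation_of_signature_relations[OF \<open>a < b\<close> X_pw time _ that]) auto
      then show ?thesis
        by (simp add: extended_path_def mul right_diff_distrib sum_subtractf)
    qed
    \<comment> \<open>The signature compares with the left end \<open>a\<close>, but the initial
      value is given at 0. Comparing both \<open>t\<close> and 0 with \<open>a\<close> moves the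
      base point, where the difference is then 0.\<close>
    then have "(A *v p t) $ i - ?dx t $ i = (A *v p 0) $ i - ?dx 0 $ i" if "t \<in> {a..b}" for t i
      using that zero by (smt (verit))
    then have dx: "?dx t = A *v p t" if "t \<in> {a..b}" for t
      using that init by (simp add: vec_eq_iff)
    have "?dp t $ i = ?dp a $ i" if "t \<in> {a..b}" for t i
    proof -
      \<comment> \<open>Again the empty sum encodes the relation with left side 0.\<close>
      have "(\<Sum>h\<in>{}. (0::real) * (?X t $ Mom h - ?X a $ Mom h)) = ?X t $ DMom i - ?X a $ DMom i"
        using rhs by (intro relation_of_signature_relations[OF \<open>a < b\<close> X_pw time _ that]) auto
      then show ?thesis
        by (simp add: extended_path_def)
    qed
    then have dp: "?dp t = - v" if "t \<in> {a..b}" for t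
      using that zero init by (metis vec_eq_iff)
    have ?curve
      unfolding curve_iff
      \<comment> \<open>Differentiability of \<open>x\<close> and \<open>p\<close> turns the
        computed values of \<open>vector_derivative\<close> into genuine derivatives.\<close>
      using x_diff p_diff dx dp
      by (metis differentiable_on_def vector_derivative_works)
    with init show "?curve \<and> ?init" by simp
  qed
qed

end
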